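(* If $K,L\in\mathcal{S}_o^n$ are such that $L\subset\operatorname{int}K$, then $$\log\!\left(\frac{V(K)-V(L)}{V(K)}\right)\ \geq\ \int_{S^{n-1}}\log\!\left(\frac{\rho(K,u)^n-\rho(L,u)^n}{\rho(K,u)^n}\right)d\tilde{V}_n(K,u),$$ with equality if and only if $K$ and $L$ are dilates.
   Context: $\mathcal{S}_o^n$ is the set of star bodies in $\mathbb{R}^n$: compact sets $K\subset\mathbb{R}^n$, star-shaped with respect to the origin, whose radial function $\rho(K,u)=\max\{\lambda\ge 0:\lambda u\in K\}$, $u\in S^{n-1}$, is positive and continuous on $S^{n-1}$. $V$ denotes $n$-dimensional volume and $S$ denotes the spherical Lebesgue (surface area) measure on $S^{n-1}$. $K$ and $L$ are dilates if $L=cK$ for some $c>0$. The dual normalized cone measure of $K\in\mathcal{S}_o^n$ is the Borel measure $\tilde{V}_n(K,\cdot)$ on $S^{n-1}$ given by $d\tilde{V}_n(K,u)=\frac{\rho(K,u)^n}{nV(K)}\,dS(u)$. *)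

theory Defs
  imports "HOL-Analysis.Analysis"
begin

text \<open>
  For compact \<open>K\<close> containing the origin and \<open>u \<noteq> 0\<close> the set of admissible \<open>l\<close> is compact
  and nonempty, so the maximum exists.
\<close>
definition radial :: "(real ^ 'n) set \<Rightarrow> real ^ 'n \<Rightarrow> real" where
  "radial K u = (GREATEST l. 0 \<le> l \<and> l *\<^sub>R u \<in> K)"

definition star_body :: "(real ^ 'n) set \<Rightarrow> bool" where
  "star_body K \<longleftrightarrow>
     compact K \<and> 0 \<in> K \<and> (\<forall>x\<in>K. closed_segment 0 x \<subseteq> K) \<and>
     (\<forall>u\<in>sphere 0 1. 0 < radial K u) \<and> continuous_on (sphere 0 1) (radial K)"

definition dilates :: "(real ^ 'n) set \<Rightarrow> (real ^ 'n) set \<Rightarrow> bool" where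
  "dilates K L \<longleftrightarrow> (\<exists>c>0. L = (\<lambda>x. c *\<^sub>R x) ` K)"

abbreviation vol :: "(real ^ 'n) set \<Rightarrow> real" where
  "vol K \<equiv> measure lebesgue K"

text \<open>
  Spherical Lebesgue measure on the Borel sets of the unit sphere, normalised as surface area:
  \<open>S(A)\<close> is \<open>n\<close> times the volume of the cone \<open>{t u | u \<in> A, 0 < t \<le> 1}\<close> over \<open>A\<close>.
\<close>
definition spherical_lebesgue :: "(real ^ 'n) measure" where
  "spherical_lebesgue =
     scale_measure (of_nat CARD('n))
       (distr (restrict_space lborel (cball 0 1 - {0})) (restrict_space borel (sphere 0 1))
          (\<lambda>x. x /\<^sub>R norm x))"

lemma emeasure_spherical_lebesgue:
  fixes A :: "(real ^ 'n) set"
  assumes "A \<in> sets borel" "A \<subseteq> sphere 0 1"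
  shows "emeasure spherical_lebesgue A =
           of_nat CARD('n) * emeasure lborel {t *\<^sub>R u | t u. u \<in> A \<and> 0 < t \<and> t \<le> 1}"
proof -
  let ?B = "cball 0 1 - {0} :: (real ^ 'n) set"
  let ?f = "\<lambda>x :: real ^ 'n. x /\<^sub>R norm x"
  have meas: "?f \<in> restrict_space lborel ?B \<rightarrow>\<^sub>M restrict_space borel (sphere 0 1)"
    by (rule measurable_restrict_space3) auto
  have A: "A \<in> sets (restrict_space borel (sphere 0 1))"
    using assms by (simp add: sets_restrict_space_iff)
  have cone: "?f -` A \<inter> ?B = {t *\<^sub>R u | t u. u \<in> A \<and> 0 < t \<and> t \<le> 1}"
  proof (intro set_eqI iffI)
    fix x assume x: "x \<in> ?f -` A \<inter> ?B"
    then have "x = norm x *\<^sub>R ?f x" "?f x \<in> A" "0 < norm x" "norm x \<le> 1" by auto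
    then show "x \<in> {t *\<^sub>R u | t u. u \<in> A \<and> 0 < t \<and> t \<le> 1}" by blast
  next
    fix x assume "x \<in> {t *\<^sub>R u | t u. u \<in> A \<and> 0 < t \<and> t \<le> 1}"
    then obtain t u where "x = t *\<^sub>R u" "u \<in> A" "0 < t" "t \<le> 1" by blast
    moreover from this assms have "norm u = 1" by auto
    ultimately show "x \<in> ?f -` A \<inter> ?B" by auto
  qed
  have "emeasure (distr (restrict_space lborel ?B) (restrict_space borel (sphere 0 1)) ?f) A
      = emeasure (restrict_space lborel ?B) (?f -` A \<inter> ?B)"
    using emeasure_distr[OF meas A] by (simp add: space_restrict_space)
  also have "\<dots> = emeasure lborel (?f -` A \<inter> ?B)"
    by (rule emeasure_restrict_space) auto
  finally show ?thesis
    unfolding spherical_lebesgue_def by (simp add: cone)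
qed

definition dual_cone_measure :: "(real ^ 'n) set \<Rightarrow> (real ^ 'n) measure" where
  "dual_cone_measure K =
     density spherical_lebesgue
       (\<lambda>u. ennreal (radial K u ^ CARD('n) / (real CARD('n) * vol K)))"

end

theory Submission
  imports Defs "HOL-Probability.Probability_Measure"
begin

text \<open>
  The dual cone measure of \<open>K\<close> is a probability measure by the polar coordinate formula
  \<open>\<integral> \<rho>(K,u)^n dS(u) = n V(K)\<close>, and the function \<open>f = 1 - (\<rho>(L,\<cdot>)/\<rho>(K,\<cdot>))^n\<close> has mean
  \<open>1 - V(L)/V(K)\<close> under it. The inequality is Jensen's inequality for the logarithm of \<open>f\<close>.
  Equality forces \<open>f\<close> to be constant almost everywhere, hence everywhere, since \<open>f\<close> is continuous
  and nonempty open subsets of the sphere have positive measure; that is, \<open>\<rho>(L,\<cdot>)\<close> is a constant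
  multiple of \<open>\<rho>(K,\<cdot>)\<close>.
\<close>

section \<open>Jensen's inequality for the logarithm\<close>

text \<open>With \<open>m\<close> the mean of \<open>f\<close>, the function
  \<open>f / m - 1 - ln (f / m)\<close> is nonnegative, vanishes exactly where \<open>f = m\<close>,
  and has expectation \<open>ln m - expectation (ln f)\<close>. Its sign gives the inequality, and
  its vanishing almost everywhere gives the equality case.\<close>

lemma (in prob_space) expectation_ln_le_ln_expectation:
  fixes f :: "'a \<Rightarrow> real"
  assumes int: "integrable M f" and int_ln: "integrable M (\<lambda>x. ln (f x))"
    and pos: "\<And>x. x \<in> space M \<Longrightarrow> 0 < f x"
  shows "expectation (\<lambda>x. ln (f x)) \<le> ln (expectation f)"
    and "expectation (\<lambda>x. ln (f x)) = ln (expectation f) \<longleftrightarrow> (AE x in M. f x = expectation f)"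
proof -
  define m where "m = expectation f"
  have "m \<ge> 0" unfolding m_def
    by (rule integral_nonneg_AE) (use pos in \<open>auto intro!: AE_I2 less_imp_le\<close>)
  \<comment> \<open>A nonnegative function of mean 0 vanishes almost everywhere, which a positive
    \<open>f\<close> cannot do on a space of total mass 1.\<close>
  moreover have "m \<noteq> 0"
  proof
    assume "m = 0"
    moreover have "AE x in M. 0 \<le> f x"
      using pos by (auto intro: less_imp_le)
    ultimately have "AE x in M. f x = 0"
      unfolding m_def using integral_nonneg_eq_0_iff_AE[OF int] by simp
    with AE_space have "AE x in M. False"
      by eventually_elim (use pos in force)
    then show False by simp
  qed
  ultimately have m: "m > 0" by simp
  \<comment> \<open>The gap in the tangent line bound \<open>ln t \<le> t - 1\<close> at
    \<open>t = f x / m\<close>. The logarithm of the quotient is split so that integrability is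
    immediate from \<open>int\<close> and \<open>int_ln\<close>.\<close>
  define g where "g x = f x / m - 1 - (ln (f x) - ln m)" for x
  have int_g: "integrable M g"
    unfolding g_def by (intro Bochner_Integration.integrable_diff int_ln) (use int in auto)
  have g: "0 \<le> g x" "g x = 0 \<longleftrightarrow> f x = m" if "x \<in> space M" for x
  proof -
    have eq: "g x = f x / m - 1 - ln (f x / m)"
      using pos[OF that] m by (simp add: g_def ln_div)
    have q: "0 < f x / m" using pos[OF that] m by simp
    show "0 \<le> g x" using ln_le_minus_one[OF q] eq by simp
    show "g x = 0 \<longleftrightarrow> f x = m" using ln_eq_minus_one[OF q] eq m by auto
  qed
  have Eg: "expectation g = ln m - expectation (\<lambda>x. ln (f x))"
    unfolding g_def using int int_ln m by (simp add: prob_space flip: m_def)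
  show "expectation (\<lambda>x. ln (f x)) \<le> ln (expectation f)"
    using integral_nonneg_AE[of g M] g Eg by (auto simp: m_def)
  have "expectation g = 0 \<longleftrightarrow> (AE x in M. g x = 0)"
    by (rule integral_nonneg_eq_0_iff_AE[OF int_g]) (use g in auto)
  also have "\<dots> \<longleftrightarrow> (AE x in M. f x = m)"
    by (rule AE_cong) (use g in auto)
  finally show "expectation (\<lambda>x. ln (f x)) = ln (expectation f) \<longleftrightarrow> (AE x in M. f x = expectation f)"
    using Eg by (auto simp: m_def)
qed

section \<open>Volumes of cones and of radially bounded regions\<close>

lemma borel_measurable_sgn_euclidean [measurable]:
  "sgn \<in> borel_measurable (borel :: 'a::euclidean_space measure)"
  unfolding sgn_div_norm[abs_def] by measurable

lemma emeasure_lborel_sphere [simp]: "emeasure lborel (sphere (c::'a::euclidean_space) r) = 0"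
  using negligible_sphere[of c r] by (simp add: negligible_iff_null_sets null_sets_def)

lemma vimage_scaleR_eq_image:
  fixes A :: "'a::real_vector set"
  assumes "r \<noteq> 0"
  shows "(\<lambda>x. x /\<^sub>R r) -` A = (*\<^sub>R) r ` A"
proof (intro set_eqI iffI)
  fix x assume "x \<in> (\<lambda>x. x /\<^sub>R r) -` A"
  then show "x \<in> (*\<^sub>R) r ` A"
    using assms by (intro image_eqI[of _ _ "x /\<^sub>R r"]) auto
qed (use assms in auto)

lemma emeasure_lborel_scaleR_image:
  fixes A :: "'a::euclidean_space set"
  assumes "A \<in> sets borel" "0 < r"
  shows "emeasure lborel ((*\<^sub>R) r ` A) = ennreal (r ^ DIM('a)) * emeasure lborel A"
proof -
  have "(*\<^sub>R) r ` A = (\<lambda>x. x /\<^sub>R r) -` A"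
    using assms(2) by (simp add: vimage_scaleR_eq_image)
  also have "\<dots> \<in> sets borel"
    using measurable_sets_borel[OF _ assms(1), of "\<lambda>x. x /\<^sub>R r"] by simp
  finally show ?thesis
    using emeasure_lebesgue_affine[of r 0 A] assms by (simp add: ennreal_power)
qed

text \<open>For \<open>c > 0\<close>, dilation by the \<open>DIM('a)\<close>-th root of
  \<open>c\<close> preserves directions and carries the unit cone to the cone on the left, so the
  volume is multiplied by \<open>c\<close>. Bounding a power of the norm makes this volume linear in
  \<open>c\<close>; for \<open>c = 0\<close> the left-hand set is empty.\<close>

lemma emeasure_cone_scaled:
  fixes A :: "'a::euclidean_space set"
  assumes A[measurable]: "A \<in> sets borel" and "0 \<le> c"
  shows "emeasure lborel {x. x \<noteq> 0 \<and> norm x ^ DIM('a) < c \<and> sgn x \<in> A}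
       = ennreal c * emeasure lborel {x. x \<noteq> 0 \<and> norm x < 1 \<and> sgn x \<in> A}"
proof (cases "c = 0")
  case False
  have C: "{x::'a. x \<noteq> 0 \<and> norm x < 1 \<and> sgn x \<in> A} \<in> sets borel" by measurable
  define r where "r = root DIM('a) c"
  have r: "0 < r" "r ^ DIM('a) = c" using False \<open>0 \<le> c\<close> by (auto simp: r_def)
  have "norm x ^ DIM('a) < c \<longleftrightarrow> norm (x /\<^sub>R r) < 1" for x :: 'a
    using power_less_imp_less_base[of "norm x" "DIM('a)" r] power_strict_mono[of "norm x" r "DIM('a)"] r
    by (auto simp: field_simps)
  moreover have "sgn (x /\<^sub>R r) = sgn x" for x :: 'a
    using r by (simp add: sgn_scaleR)
  ultimately have "{x. x \<noteq> 0 \<and> norm x ^ DIM('a) < c \<and> sgn x \<in> A}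
      = (\<lambda>x. x /\<^sub>R r) -` {x. x \<noteq> 0 \<and> norm x < 1 \<and> sgn x \<in> A}"
    using r by auto
  also have "\<dots> = (*\<^sub>R) r ` {x. x \<noteq> 0 \<and> norm x < 1 \<and> sgn x \<in> A}"
    using r(1) by (intro vimage_scaleR_eq_image) simp
  finally show ?thesis
    using emeasure_lborel_scaleR_image[OF C r(1)] r(2) by simp
qed auto

text \<open>The region splits into finitely many disjoint cones, one over each level set of
  \<open>f\<close>; the cone over \<open>f = y\<close> has \<open>y\<close> times the volume of the
  corresponding unit cone.\<close>

lemma emeasure_radial_set_simple:
  fixes f :: "'a::euclidean_space \<Rightarrow> ennreal"
  assumes f: "simple_function borel f" and fin: "\<And>u. f u < top"
  shows "emeasure lborel {x. x \<noteq> 0 \<and> ennreal (norm x ^ DIM('a)) < f (sgn x)}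
       = (\<integral>\<^sup>+x. f (sgn x) * indicator (ball 0 1 - {0}) x \<partial>lborel)"
proof -
  note [measurable] = borel_measurable_simple_function[OF f]
  have finr: "finite (range f)" using simple_functionD(1)[OF f] by simp
  define C where "C y = {x::'a. x \<noteq> 0 \<and> norm x < 1 \<and> sgn x \<in> f -` {y}}" for y
  \<comment> \<open>\<open>enn2real\<close> sends \<open>top\<close> to 0; the hypothesis
    \<open>fin\<close> ensures that this default never occurs for a value of
    \<open>f\<close>.\<close>
  define D where "D y = {x::'a. x \<noteq> 0 \<and> norm x ^ DIM('a) < enn2real y \<and> sgn x \<in> f -` {y}}" for y
  have fm[measurable]: "f -` {y} \<in> sets borel" for y
    using simple_functionD(2)[OF f] by simp
  have C[measurable]: "C y \<in> sets borel" and D[measurable]: "D y \<in> sets borel" for y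
    unfolding C_def D_def by measurable
  have "{x. x \<noteq> 0 \<and> ennreal (norm x ^ DIM('a)) < f (sgn x)} = (\<Union>y\<in>range f. D y)"
  proof -
    have "ennreal (norm x ^ DIM('a)) < f (sgn x) \<longleftrightarrow> norm x ^ DIM('a) < enn2real (f (sgn x))" for x :: 'a
      using fin[of "sgn x"] by (cases "f (sgn x)") (auto simp: ennreal_less_iff)
    then have "x \<in> {x. x \<noteq> 0 \<and> ennreal (norm x ^ DIM('a)) < f (sgn x)} \<longleftrightarrow> x \<in> D (f (sgn x))" for x
      by (simp add: D_def)
    moreover have "x \<in> (\<Union>y\<in>range f. D y) \<longleftrightarrow> x \<in> D (f (sgn x))" for x
    proof
      assume "x \<in> (\<Union>y\<in>range f. D y)"
      then obtain y where y: "x \<in> D y" by (rule UN_E)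
      then have "f (sgn x) = y" by (simp add: D_def)
      with y show "x \<in> D (f (sgn x))" by simp
    next
      assume "x \<in> D (f (sgn x))"
      then show "x \<in> (\<Union>y\<in>range f. D y)" by (rule UN_I[OF rangeI])
    qed
    ultimately show ?thesis by (intro set_eqI) (simp only:)
  qed
  also have "emeasure lborel \<dots> = (\<Sum>y\<in>range f. emeasure lborel (D y))"
    by (rule sum_emeasure[symmetric]) (auto simp: finr disjoint_family_on_def D_def)
  also have "\<dots> = (\<Sum>y\<in>range f. y * emeasure lborel (C y))"
  proof (rule sum.cong[OF refl])
    fix y assume "y \<in> range f"
    then have "ennreal (enn2real y) = y" using fin by auto
    then show "emeasure lborel (D y) = y * emeasure lborel (C y)"
      using emeasure_cone_scaled[OF fm[of y], of "enn2real y"] by (simp add: C_def D_def)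
  qed
  also have "\<dots> = (\<integral>\<^sup>+x. (\<Sum>y\<in>range f. y * indicator (C y) x) \<partial>lborel)"
    by (subst nn_integral_sum) (auto simp: nn_integral_cmult)
  also have "\<dots> = (\<integral>\<^sup>+x. f (sgn x) * indicator (ball 0 1 - {0}) x \<partial>lborel)"
  proof (rule nn_integral_cong)
    fix x :: 'a
    have "(\<Sum>y\<in>range f. y * indicator (C y) x)
        = (\<Sum>y\<in>range f. if y = f (sgn x) then y * indicator (ball 0 1 - {0}) x else 0)"
      by (rule sum.cong) (auto simp: C_def indicator_def)
    also have "\<dots> = f (sgn x) * indicator (ball 0 1 - {0}) x"
      using finr by (subst sum.delta) auto
    finally show "(\<Sum>y\<in>range f. y * indicator (C y) x) = f (sgn x) * indicator (ball 0 1 - {0}) x" .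
  qed
  finally show ?thesis .
qed

text \<open>
  Polar coordinates without a product decomposition of Lebesgue measure: both sides are computed on
  cones, i.e. for simple \<open>g\<close>, and pass to increasing limits. The strict inequality is what makes the
  left-hand side continuous in \<open>g\<close> from below.
\<close>
lemma emeasure_radial_set:
  fixes g :: "'a::euclidean_space \<Rightarrow> ennreal"
  assumes g[measurable]: "g \<in> borel_measurable borel"
  shows "emeasure lborel {x. x \<noteq> 0 \<and> ennreal (norm x ^ DIM('a)) < g (sgn x)}
       = (\<integral>\<^sup>+x. g (sgn x) * indicator (ball 0 1 - {0}) x \<partial>lborel)"
proof -
  obtain f where f: "\<And>i. simple_function borel (f i)" "incseq f" "\<And>i x. f i x < top"
      "\<And>x. (SUP i. f i x) = g x"
    using borel_measurable_implies_simple_function_sequence'[OF g] by metis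
  note [measurable] = borel_measurable_simple_function[OF f(1)]
  define D where "D h = {x::'a. x \<noteq> 0 \<and> ennreal (norm x ^ DIM('a)) < h (sgn x)}" for h
  have "D g = (\<Union>i. D (f i))"
    unfolding D_def f(4)[symmetric] by (auto simp: less_SUP_iff)
  then have "emeasure lborel (D g) = emeasure lborel (\<Union>i. D (f i))" by simp
  also have "\<dots> = (SUP i. emeasure lborel (D (f i)))"
  proof (rule SUP_emeasure_incseq[symmetric])
    show "range (\<lambda>i. D (f i)) \<subseteq> sets lborel" unfolding D_def by auto
    show "incseq (\<lambda>i. D (f i))"
      using f(2) unfolding D_def by (auto simp: incseq_def le_fun_def intro: less_le_trans)
  qed
  also have "\<dots> = (SUP i. \<integral>\<^sup>+x. f i (sgn x) * indicator (ball 0 1 - {0}) x \<partial>lborel)"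
    unfolding D_def by (subst emeasure_radial_set_simple) (auto simp: f)
  also have "\<dots> = (\<integral>\<^sup>+x. (SUP i. f i (sgn x) * indicator (ball 0 1 - {0}) x) \<partial>lborel)"
  proof (rule nn_integral_monotone_convergence_SUP[symmetric])
    show "incseq (\<lambda>i x. f i (sgn x) * indicator (ball 0 1 - {0}) x)"
      using f(2) by (auto simp: incseq_def le_fun_def intro!: mult_right_mono)
    have [measurable]: "ball 0 1 - {0::'a} \<in> sets borel" by auto
    show "(\<lambda>x. f i (sgn x) * indicator (ball 0 1 - {0}) x) \<in> borel_measurable lborel" for i
      by measurable
  qed
  also have "\<dots> = (\<integral>\<^sup>+x. g (sgn x) * indicator (ball 0 1 - {0}) x \<partial>lborel)"
    by (simp add: f(4) flip: SUP_mult_right_ennreal)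
  finally show ?thesis by (simp add: D_def)
qed

section \<open>Integration over the sphere\<close>

abbreviation usphere :: "(real ^ 'n) measure" where
  "usphere \<equiv> restrict_space borel (sphere 0 1)"

lemma sets_spherical_lebesgue [simp, measurable_cong]:
  "sets (spherical_lebesgue :: (real ^ 'n) measure) = sets usphere"
  by (simp add: spherical_lebesgue_def)

lemma space_spherical_lebesgue [simp]: "space (spherical_lebesgue :: (real ^ 'n) measure) = sphere 0 1"
  by (simp add: spherical_lebesgue_def space_scale_measure space_restrict_space)

lemma measurable_sgn_usphere:
  "(\<lambda>x. x /\<^sub>R norm x) \<in> restrict_space lborel (cball 0 1 - {0}) \<rightarrow>\<^sub>M (usphere :: (real ^ 'n) measure)"
  by (rule measurable_restrict_space3) auto

text \<open>As the measure is a scaled pushforward from the punctured ball, the left-hand side is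
  \<open>CARD('n)\<close> times the integral of \<open>g (sgn x)\<close> over that ball, which is
  the volume of a radial region.\<close>

lemma nn_integral_spherical_lebesgue:
  fixes g :: "real ^ 'n \<Rightarrow> ennreal"
  assumes g: "g \<in> borel_measurable usphere"
  shows "(\<integral>\<^sup>+u. g u \<partial>spherical_lebesgue)
       = of_nat CARD('n) * emeasure lborel {x. x \<noteq> 0 \<and> ennreal (norm x ^ CARD('n)) < g (sgn x)}"
proof -
  \<comment> \<open>Extending \<open>g\<close> by zero makes it Borel on the whole space; the values
    at \<open>sgn x\<close> with \<open>x \<noteq> 0\<close> are unchanged.\<close>
  define G where "G u = g u * indicator (sphere 0 1) u" for u
  have G[measurable]: "G \<in> borel_measurable borel"
    using g unfolding G_def by (subst (asm) borel_measurable_restrict_space_iff_ennreal) auto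
  have sgn_sphere: "sgn x \<in> sphere 0 1" if "x \<noteq> 0" for x :: "real ^ 'n"
    using that by (simp add: norm_sgn)
  have "(\<integral>\<^sup>+u. g u \<partial>spherical_lebesgue) = of_nat CARD('n) *
      (\<integral>\<^sup>+x. g (x /\<^sub>R norm x) \<partial>restrict_space lborel (cball 0 1 - {0}))"
    unfolding spherical_lebesgue_def
    by (subst nn_integral_scale_measure)
       (auto simp: g nn_integral_distr[OF measurable_sgn_usphere])
  also have "(\<integral>\<^sup>+x. g (x /\<^sub>R norm x) \<partial>restrict_space lborel (cball 0 1 - {0}))
      = (\<integral>\<^sup>+x. g (x /\<^sub>R norm x) * indicator (cball 0 1 - {0}) x \<partial>lborel)"
    by (rule nn_integral_restrict_space) auto
  also have "\<dots> = (\<integral>\<^sup>+x. G (sgn x) * indicator (ball 0 1 - {0}) x \<partial>lborel)"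
  \<comment> \<open>The closed ball of the definition and the open ball of the radial region formula
    differ by the unit sphere, a null set.\<close>
  proof (rule nn_integral_cong_AE)
    have "AE x in lborel. x \<notin> sphere (0 :: real ^ 'n) 1"
      by (rule AE_not_in) (auto simp: null_sets_def)
    then show "AE x in lborel. g (x /\<^sub>R norm x) * indicator (cball 0 1 - {0}) x
        = G (sgn x) * indicator (ball 0 1 - {0}) x"
      by eventually_elim (use sgn_sphere in \<open>auto simp: G_def sgn_div_norm indicator_def\<close>)
  qed
  also have "\<dots> = emeasure lborel {x. x \<noteq> 0 \<and> ennreal (norm x ^ CARD('n)) < G (sgn x)}"
    using emeasure_radial_set[OF G] by simp
  also have "{x. x \<noteq> 0 \<and> ennreal (norm x ^ CARD('n)) < G (sgn x)}
      = {x. x \<noteq> 0 \<and> ennreal (norm x ^ CARD('n)) < g (sgn x)}"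
    using sgn_sphere by (auto simp: G_def)
  finally show ?thesis .
qed

lemma sets_radial_set:
  fixes g :: "real ^ 'n \<Rightarrow> ennreal"
  assumes g: "g \<in> borel_measurable usphere"
  shows "{x. x \<noteq> 0 \<and> ennreal (norm x ^ k) < g (sgn x)} \<in> sets borel"
proof -
  define G where "G u = g u * indicator (sphere 0 1) u" for u
  have G[measurable]: "G \<in> borel_measurable borel"
    using g unfolding G_def by (subst (asm) borel_measurable_restrict_space_iff_ennreal) auto
  have "{x. x \<noteq> 0 \<and> ennreal (norm x ^ k) < g (sgn x)} = {x. x \<noteq> 0 \<and> ennreal (norm x ^ k) < G (sgn x)}"
    by (auto simp: G_def norm_sgn)
  also have "\<dots> \<in> sets borel" by measurable
  finally show ?thesis .
qed

section \<open>Radial functions of star bodies\<close>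

text \<open>\<open>GREATEST\<close> is meaningful only if a maximum exists: the admissible factors
  contain 0, form a closed set because \<open>K\<close> is closed, and are bounded because
  \<open>l\<close> is the norm of \<open>l *\<^sub>R u\<close>.\<close>

lemma star_body_radial:
  assumes "star_body K" "norm u = 1"
  shows radial_nonneg: "0 \<le> radial K u" and radial_in: "radial K u *\<^sub>R u \<in> K"
    and radial_greatest: "\<And>l. 0 \<le> l \<Longrightarrow> l *\<^sub>R u \<in> K \<Longrightarrow> l \<le> radial K u"
proof -
  let ?P = "\<lambda>l. 0 \<le> l \<and> l *\<^sub>R u \<in> K"
  let ?S = "{l. ?P l}"
  have K: "compact K" "0 \<in> K" using assms by (auto simp: star_body_def)
  obtain b where b: "\<And>x. x \<in> K \<Longrightarrow> norm x \<le> b"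
    using K(1) compact_imp_bounded bounded_iff by metis
  have "bounded ?S"
    unfolding bounded_iff using b assms(2) by (intro exI[of _ b]) force
  moreover have "closed ?S"
  proof -
    have "closed ({0..} \<inter> (\<lambda>l. l *\<^sub>R u) -` K)"
      by (intro closed_Int closed_atLeast closed_vimage compact_imp_closed[OF K(1)] continuous_intros)
    moreover have "{0..} \<inter> (\<lambda>l. l *\<^sub>R u) -` K = ?S" by auto
    ultimately show ?thesis by simp
  qed
  ultimately have "compact ?S" by (simp add: compact_eq_bounded_closed)
  moreover have "0 \<in> ?S" using K by simp
  ultimately obtain m where m: "m \<in> ?S" "\<And>l. l \<in> ?S \<Longrightarrow> l \<le> m"
    using compact_attains_sup[of ?S] by blast
  then have "radial K u = m"
    unfolding radial_def by (intro Greatest_equality) auto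
  with m show "0 \<le> radial K u" "radial K u *\<^sub>R u \<in> K"
    "\<And>l. 0 \<le> l \<Longrightarrow> l *\<^sub>R u \<in> K \<Longrightarrow> l \<le> radial K u" by auto
qed

lemma radial_pos: "star_body K \<Longrightarrow> norm u = 1 \<Longrightarrow> 0 < radial K u"
  by (auto simp: star_body_def)

lemma continuous_on_radial: "star_body K \<Longrightarrow> continuous_on (sphere 0 1) (radial K)"
  by (simp add: star_body_def)

lemma borel_measurable_radial: "star_body K \<Longrightarrow> radial K \<in> borel_measurable usphere"
  by (intro borel_measurable_continuous_on_restrict continuous_on_radial)

text \<open>Maximality of the radial function gives one direction, star-shapedness applied to the
  boundary point on the ray gives the other. The origin is excluded because \<open>sgn 0\<close> is
  not a unit vector.\<close>

lemma mem_star_body_iff: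
  assumes K: "star_body K" and x: "x \<noteq> 0"
  shows "x \<in> K \<longleftrightarrow> norm x \<le> radial K (sgn x)"
proof
  have u: "norm (sgn x) = 1" using x by (simp add: norm_sgn)
  have xu: "x = norm x *\<^sub>R sgn x" using x by (simp add: sgn_div_norm)
  show "norm x \<le> radial K (sgn x)" if "x \<in> K"
    using radial_greatest[OF K u, of "norm x"] that xu by simp
  assume le: "norm x \<le> radial K (sgn x)"
  have "x \<in> closed_segment 0 (radial K (sgn x) *\<^sub>R sgn x)"
    unfolding in_segment
  proof (intro exI conjI)
    show "x = (1 - norm x / radial K (sgn x)) *\<^sub>R 0 + (norm x / radial K (sgn x)) *\<^sub>R (radial K (sgn x) *\<^sub>R sgn x)"
      using radial_pos[OF K u] xu by simp
  qed (use le radial_pos[OF K u] in auto)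
  then show "x \<in> K" using K radial_in[OF K u] unfolding star_body_def by blast
qed

section \<open>Volume in polar coordinates\<close>

text \<open>Regions \<open>D t\<close>, whose volume is linear in \<open>t\<close>, enclose the
  body: \<open>D 1\<close> lies in \<open>K\<close>, and \<open>K - {0}\<close> lies in
  \<open>D t\<close> for every \<open>t > 1\<close>. Letting \<open>t\<close> decrease to 1 pins
  down the integral.\<close>

lemma nn_integral_radial_power:
  fixes K :: "(real ^ 'n) set"
  assumes K: "star_body K"
  shows "(\<integral>\<^sup>+u. ennreal (radial K u ^ CARD('n)) \<partial>spherical_lebesgue) = ennreal (real CARD('n) * vol K)"
proof -
  let ?n = "CARD('n)"
  have cK: "compact K" using K by (simp add: star_body_def)
  note [measurable] = borel_measurable_radial[OF K]
  \<comment> \<open>\<open>vol\<close> refers to \<open>lebesgue\<close> and the radial regions to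
    \<open>lborel\<close>; the two agree on \<open>K\<close>, which is compact, hence Borel and of
    finite volume.\<close>
  have emK: "emeasure lborel K = ennreal (vol K)"
    using emeasure_compact_finite[OF cK] borel_compact[OF cK] emeasure_eq_ennreal_measure[of lborel K]
    by (simp add: measure_def)
  define I where "I = (\<integral>\<^sup>+u. ennreal (radial K u ^ ?n) \<partial>spherical_lebesgue)"
  define D where "D t = {x. x \<noteq> 0 \<and> ennreal (norm x ^ ?n) < ennreal (t * radial K (sgn x) ^ ?n)}" for t
  have D: "ennreal t * I = of_nat ?n * emeasure lborel (D t)" if "t > 0" for t
  proof -
    have "of_nat ?n * emeasure lborel (D t) = (\<integral>\<^sup>+u. ennreal (t * radial K u ^ ?n) \<partial>spherical_lebesgue)"
      unfolding D_def by (subst nn_integral_spherical_lebesgue) auto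
    also have "\<dots> = (\<integral>\<^sup>+u. ennreal t * ennreal (radial K u ^ ?n) \<partial>spherical_lebesgue)"
      using that by (simp add: ennreal_mult')
    also have "\<dots> = ennreal t * I"
      unfolding I_def by (rule nn_integral_cmult) measurable
    finally show ?thesis ..
  qed
  have D1: "D 1 \<subseteq> K"
  proof
    fix x assume x: "x \<in> D 1"
    then have "norm (sgn x) = 1" by (auto simp: D_def norm_sgn)
    from x radial_nonneg[OF K this] have "norm x < radial K (sgn x)"
      by (auto simp: D_def ennreal_less_iff intro: power_less_imp_less_base)
    then show "x \<in> K" using mem_star_body_iff[OF K] x by (auto simp: D_def)
  qed
  \<comment> \<open>\<open>D 1\<close> misses the boundary of \<open>K\<close>, so the reverse bound is obtained from \<open>t \<rightarrow> 1\<close>.\<close>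
  have Dt: "K - {0} \<subseteq> D t" if "t > 1" for t
  proof
    fix x assume x: "x \<in> K - {0}"
    then have u: "norm (sgn x) = 1" by (auto simp: norm_sgn)
    have "norm x \<le> radial K (sgn x)" using mem_star_body_iff[OF K, of x] x by auto
    then have "norm x ^ ?n \<le> radial K (sgn x) ^ ?n" by (intro power_mono) auto
    also have "\<dots> < t * radial K (sgn x) ^ ?n" using radial_pos[OF K u] that by simp
    finally show "x \<in> D t" using x by (auto simp: D_def ennreal_less_iff)
  qed
  have K_borel: "K \<in> sets borel" using cK by (simp add: borel_compact)
  have "I = of_nat ?n * emeasure lborel (D 1)" using D[of 1] by simp
  also have "\<dots> \<le> of_nat ?n * emeasure lborel K"
    using D1 K_borel by (intro mult_left_mono emeasure_mono) auto
  also have "\<dots> = ennreal (?n * vol K)"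
    by (simp add: emK ennreal_mult' ennreal_of_nat_eq_real_of_nat)
  finally have le: "I \<le> ennreal (?n * vol K)" .
  \<comment> \<open>The upper bound makes the integral finite, so the limit can be taken in the
    reals.\<close>
  then obtain i where i: "I = ennreal i" "0 \<le> i" "i \<le> ?n * vol K"
    by (cases I) (auto simp: top_unique)
  have "?n * vol K \<le> t * i" if "t > 1" for t
  proof -
    have "D t \<in> sets lborel"
      unfolding D_def using sets_radial_set[of "\<lambda>u. ennreal (t * radial K u ^ ?n)"] by simp
    have "ennreal (?n * vol K) = of_nat ?n * emeasure lborel K"
      by (simp add: emK ennreal_mult' ennreal_of_nat_eq_real_of_nat)
    also have "emeasure lborel K = emeasure lborel (K - {0})"
      by (rule emeasure_Diff_null_set[symmetric]) (auto simp: K_borel null_sets_def)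
    also have "of_nat ?n * \<dots> \<le> of_nat ?n * emeasure lborel (D t)"
      using Dt[OF that] \<open>D t \<in> sets lborel\<close> by (intro mult_left_mono emeasure_mono) auto
    also have "\<dots> = ennreal (t * i)" using D[of t] that i by (simp add: ennreal_mult')
    finally show ?thesis using that i by (simp add: ennreal_le_iff)
  qed
  then have "?n * vol K \<le> i"
  proof -
    have "((\<lambda>t. t * i) \<longlongrightarrow> 1 * i) (at_right 1)" by (intro tendsto_intros)
    moreover have "eventually (\<lambda>t. ?n * vol K \<le> t * i) (at_right 1)"
      using \<open>\<And>t. t > 1 \<Longrightarrow> ?n * vol K \<le> t * i\<close> by (auto simp: eventually_at_filter)
    ultimately show ?thesis using tendsto_lowerbound[of "\<lambda>t. t * i" "1 * i" "at_right 1"] by simp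
  qed
  with i show ?thesis by (simp add: I_def)
qed


lemma integral_radial_power:
  fixes K :: "(real ^ 'n) set"
  assumes K: "star_body K"
  shows "(\<integral>u. radial K u ^ CARD('n) \<partial>spherical_lebesgue) = real CARD('n) * vol K"
proof -
  note [measurable] = borel_measurable_radial[OF K]
  have "(\<integral>u. radial K u ^ CARD('n) \<partial>spherical_lebesgue)
      = enn2real (\<integral>\<^sup>+u. ennreal (radial K u ^ CARD('n)) \<partial>spherical_lebesgue)"
    by (rule integral_eq_nn_integral) (use radial_nonneg[OF K] in \<open>auto intro!: AE_I2\<close>)
  then show ?thesis by (simp add: nn_integral_radial_power[OF K])
qed

section \<open>Rigidity and comparison of radial functions\<close>

text \<open>If \<open>g\<close> differed from \<open>c\<close> somewhere, the part of the open unit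
  ball lying over the exceptional directions would be open and nonempty, hence of positive volume.
  That volume is a multiple of the spherical measure of those directions, which is 0.\<close>

lemma AE_spherical_lebesgue_const_continuous:
  fixes g :: "real ^ 'n \<Rightarrow> real"
  assumes cont: "continuous_on (sphere 0 1) g"
    and ae: "AE u in spherical_lebesgue. g u = c" and u: "norm u = 1"
  shows "g u = c"
proof (rule ccontr)
  assume "g u \<noteq> c"
  note [measurable] = borel_measurable_continuous_on_restrict[OF cont]
  define A where "A = {u \<in> sphere 0 1. g u \<noteq> c}"
  have "{u \<in> space usphere. g u \<noteq> c} \<in> sets usphere" by measurable
  then have A: "A \<in> sets usphere" by (simp add: A_def space_restrict_space)
  have "emeasure spherical_lebesgue A = 0"
    using AE_E2[OF ae] A by (simp add: A_def)
  moreover have "emeasure spherical_lebesgue A = (\<integral>\<^sup>+u. indicator A u \<partial>spherical_lebesgue)"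
    using A by simp
  moreover have "\<dots> = of_nat CARD('n) *
      emeasure lborel {x. x \<noteq> 0 \<and> ennreal (norm x ^ CARD('n)) < indicator A (sgn x)}"
    using A by (intro nn_integral_spherical_lebesgue) simp
  \<comment> \<open>For the 0/1-valued indicator, the radial condition says exactly that
    \<open>norm x < 1\<close> and \<open>sgn x\<close> lies in \<open>A\<close>.\<close>
  moreover have "{x. x \<noteq> 0 \<and> ennreal (norm x ^ CARD('n)) < indicator A (sgn x)}
      = {x \<in> ball 0 1 - {0}. g (sgn x) \<in> - {c}}" (is "_ = ?U")
    by (auto simp: A_def indicator_def norm_sgn power_less_one_iff ennreal_less_iff
        simp flip: ennreal_1 split: if_splits)
  ultimately have null: "emeasure lborel ?U = 0" by simp
  have "open ?U"
  proof -
    have "continuous_on (ball 0 1 - {0::real ^ 'n}) sgn"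
      unfolding sgn_div_norm[abs_def] by (intro continuous_intros) auto
    then have "continuous_on (ball 0 1 - {0}) (\<lambda>x. g (sgn x))"
      by (rule continuous_on_compose2[OF cont]) (auto simp: norm_sgn split: if_splits)
    then have "open ((ball 0 1 - {0}) \<inter> (\<lambda>x. g (sgn x)) -` (- {c}))"
      by (rule continuous_open_preimage) auto
    then show ?thesis by (simp add: vimage_def Int_def)
  qed
  moreover have "u /\<^sub>R 2 \<in> ?U"
    using u \<open>g u \<noteq> c\<close> by (auto simp: sgn_scaleR sgn_div_norm)
  ultimately have "\<not> negligible ?U" using open_not_negligible by blast
  with null \<open>open ?U\<close> show False
    by (simp add: negligible_iff_null_sets null_sets_def)
qed

text \<open>The last point of \<open>L\<close> on the ray is interior to \<open>K\<close>, so the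
  ray stays in \<open>K\<close> for a further length \<open>e / 2\<close>.\<close>

lemma radial_less_of_subset_interior:
  assumes K: "star_body K" and L: "star_body L" and sub: "L \<subseteq> interior K" and u: "norm u = 1"
  shows "radial L u < radial K u"
proof -
  have "radial L u *\<^sub>R u \<in> interior K" using radial_in[OF L u] sub by blast
  then obtain e where e: "e > 0" "ball (radial L u *\<^sub>R u) e \<subseteq> K"
    by (auto simp: mem_interior)
  have "dist (radial L u *\<^sub>R u) ((radial L u + e / 2) *\<^sub>R u) < e"
    using e u by (simp add: dist_norm flip: scaleR_diff_left)
  with e have "(radial L u + e / 2) *\<^sub>R u \<in> K" by auto
  then have "radial L u + e / 2 \<le> radial K u"
    using radial_greatest[OF K u] radial_nonneg[OF L u] e by simp
  with e show ?thesis by simp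
qed

text \<open>The radial function scales linearly with the body and, by
  \<open>mem_star_body_iff\<close>, determines it.\<close>

lemma dilates_iff_radial:
  assumes K: "star_body K" and L: "star_body L"
  shows "dilates K L \<longleftrightarrow> (\<exists>c>0. \<forall>u\<in>sphere 0 1. radial L u = c * radial K u)"
proof
  assume "dilates K L"
  then obtain c where c: "c > 0" "L = (\<lambda>x. c *\<^sub>R x) ` K" by (auto simp: dilates_def)
  have "radial L u = c * radial K u" if u: "norm u = 1" for u
  proof (rule antisym)
    obtain x where x: "radial L u *\<^sub>R u = c *\<^sub>R x" "x \<in> K"
      using radial_in[OF L u] c by auto
    have "x = (1 / c) *\<^sub>R (c *\<^sub>R x)" using c(1) by simp
    also have "\<dots> = (radial L u / c) *\<^sub>R u" unfolding x(1)[symmetric] by simp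
    finally have "(radial L u / c) *\<^sub>R u \<in> K" using x(2) by simp
    then have "radial L u / c \<le> radial K u"
      using radial_greatest[OF K u] radial_nonneg[OF L u] c(1) by simp
    then show "radial L u \<le> c * radial K u" using c(1) by (simp add: field_simps)
    have "(c * radial K u) *\<^sub>R u \<in> L"
      using radial_in[OF K u] c(2) by force
    then show "c * radial K u \<le> radial L u"
      using radial_greatest[OF L u] radial_nonneg[OF K u] c(1) by simp
  qed
  with c show "\<exists>c>0. \<forall>u\<in>sphere 0 1. radial L u = c * radial K u" by auto
next
  assume "\<exists>c>0. \<forall>u\<in>sphere 0 1. radial L u = c * radial K u"
  then obtain c where c: "c > 0" "\<And>u. norm u = 1 \<Longrightarrow> radial L u = c * radial K u" by auto
  have "x \<in> L \<longleftrightarrow> x /\<^sub>R c \<in> K" for x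
  proof (cases "x = 0")
    case False
    then have "sgn (x /\<^sub>R c) = sgn x" "norm (sgn x) = 1"
      using c by (auto simp: sgn_scaleR norm_sgn)
    then show ?thesis
      using mem_star_body_iff[OF L, of x] mem_star_body_iff[OF K, of "x /\<^sub>R c"] False c
      by (simp add: field_simps)
  qed (use K L in \<open>auto simp: star_body_def\<close>)
  then have "L = (\<lambda>x. x /\<^sub>R c) -` K" by auto
  then have "L = (\<lambda>x. c *\<^sub>R x) ` K" using c by (simp add: vimage_scaleR_eq_image)
  with c show "dilates K L" by (auto simp: dilates_def)
qed

section \<open>The dual cone measure as a probability measure\<close>

lemma sets_dual_cone_measure [simp, measurable_cong]: "sets (dual_cone_measure K) = sets usphere"
  by (simp add: dual_cone_measure_def)

lemma space_dual_cone_measure [simp]: "space (dual_cone_measure K) = sphere 0 1"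
  by (simp add: dual_cone_measure_def)

lemma prob_space_dual_cone_measure:
  fixes K :: "(real ^ 'n) set"
  assumes K: "star_body K" and pos: "0 < vol K"
  shows "prob_space (dual_cone_measure K)"
proof
  let ?c = "1 / (real CARD('n) * vol K)"
  note [measurable] = borel_measurable_radial[OF K]
  have "emeasure (dual_cone_measure K) (space (dual_cone_measure K))
      = (\<integral>\<^sup>+u. ennreal (radial K u ^ CARD('n) / (real CARD('n) * vol K)) \<partial>spherical_lebesgue)"
  proof -
    have "sphere 0 1 \<in> sets (spherical_lebesgue :: (real ^ 'n) measure)"
      using sets.top[of "spherical_lebesgue :: (real ^ 'n) measure"] by simp
    then have "emeasure (dual_cone_measure K) (sphere 0 1)
      = (\<integral>\<^sup>+u. ennreal (radial K u ^ CARD('n) / (real CARD('n) * vol K)) * indicator (sphere 0 1) u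
          \<partial>spherical_lebesgue)"
      unfolding dual_cone_measure_def by (subst emeasure_density) auto
    also have "\<dots> = (\<integral>\<^sup>+u. ennreal (radial K u ^ CARD('n) / (real CARD('n) * vol K)) \<partial>spherical_lebesgue)"
      by (rule nn_integral_cong) simp
    finally show ?thesis by simp
  qed
  also have "\<dots> = (\<integral>\<^sup>+u. ennreal ?c * ennreal (radial K u ^ CARD('n)) \<partial>spherical_lebesgue)"
    using pos by (intro nn_integral_cong) (simp flip: ennreal_mult')
  also have "\<dots> = ennreal ?c * ennreal (real CARD('n) * vol K)"
    by (subst nn_integral_cmult) (auto simp: nn_integral_radial_power[OF K])
  also have "\<dots> = 1" using pos by (simp flip: ennreal_mult')
  finally show "emeasure (dual_cone_measure K) (space (dual_cone_measure K)) = 1" .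
qed

section \<open>The logarithmic inequality and its equality case\<close>

theorem corollary6p2:
  fixes K L :: "(real ^ 'n) set"
  assumes "star_body K" and "star_body L" and "L \<subseteq> interior K"
  shows "ln ((vol K - vol L) / vol K)
           \<ge> (\<integral>u. ln ((radial K u ^ CARD('n) - radial L u ^ CARD('n)) / radial K u ^ CARD('n))
                \<partial>dual_cone_measure K)
       \<and> (ln ((vol K - vol L) / vol K)
            = (\<integral>u. ln ((radial K u ^ CARD('n) - radial L u ^ CARD('n)) / radial K u ^ CARD('n))
                \<partial>dual_cone_measure K)
          \<longleftrightarrow> dilates K L)"
proof -
  note K = assms(1) and L = assms(2)
  let ?n = "CARD('n)" and ?P = "dual_cone_measure K"
  define f where "f u = (radial K u ^ ?n - radial L u ^ ?n) / radial K u ^ ?n" for u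
  note [measurable] = borel_measurable_radial[OF K] borel_measurable_radial[OF L]
  have K_pos: "0 < radial K u" if "norm u = 1" for u using radial_pos[OF K that] .
  have f_pos: "0 < f u" if "norm u = 1" for u
    using K_pos[OF that] radial_nonneg[OF L that]
      power_strict_mono[OF radial_less_of_subset_interior[OF assms that]]
    by (simp add: f_def)
  have f_eq: "f u = 1 - (radial L u / radial K u) ^ ?n" if "norm u = 1" for u
    using K_pos[OF that] by (simp add: f_def diff_divide_distrib power_divide)
  have volK: "0 < vol K"
  proof -
    \<comment> \<open>The origin lies in \<open>L\<close>, hence in the interior of
      \<open>K\<close>, which is therefore a nonempty open set of positive volume.\<close>
    have "0 \<in> interior K" using L assms(3) by (auto simp: star_body_def)
    then have "\<not> negligible K"
      using open_not_negligible[of "interior K"] negligible_subset[OF _ interior_subset] by blast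
    moreover have "K \<in> lmeasurable" using K by (simp add: star_body_def lmeasurable_compact)
    ultimately show ?thesis
      using negligible_iff_measure0 measure_nonneg[of lebesgue K] by (metis less_le)
  qed
  interpret prob_space ?P by (rule prob_space_dual_cone_measure[OF K volK])
  \<comment> \<open>Compactness of the sphere bounds every continuous function on it, which settles
    all integrability conditions at once, including the one for \<open>ln (f u)\<close>.\<close>
  have int_cont: "integrable ?P g" if "continuous_on (sphere 0 1) g" for g :: "real ^ 'n \<Rightarrow> real"
  proof -
    have "bounded (g ` sphere 0 1)"
      using compact_continuous_image[OF that] by (simp add: compact_imp_bounded)
    then obtain B where "\<forall>u\<in>sphere 0 1. norm (g u) \<le> B" by (auto simp: bounded_iff)
    then show ?thesis
      using borel_measurable_continuous_on_restrict[OF that]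
      by (intro integrable_const_bound[of _ B]) auto
  qed
  have cont_f: "continuous_on (sphere 0 1) f"
    unfolding f_def using K_pos
    by (intro continuous_intros continuous_on_radial K L) force
  have int_f: "integrable ?P f" by (rule int_cont[OF cont_f])
  have int_ln: "integrable ?P (\<lambda>u. ln (f u))"
    by (intro int_cont continuous_on_ln cont_f) (use f_pos in force)
  have Ef: "expectation f = (vol K - vol L) / vol K"
  proof -
    have int_q: "integrable ?P (\<lambda>u. (radial L u / radial K u) ^ ?n)"
      using K_pos by (intro int_cont continuous_intros continuous_on_radial K L) force
    \<comment> \<open>The density of the measure cancels the denominator, leaving the polar integral
      for the volume of \<open>L\<close>.\<close>
    have "expectation (\<lambda>u. (radial L u / radial K u) ^ ?n)
        = (\<integral>u. radial K u ^ ?n / (real ?n * vol K) * (radial L u / radial K u) ^ ?n \<partial>spherical_lebesgue)"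
      unfolding dual_cone_measure_def
      by (subst integral_density) (use radial_nonneg[OF K] in \<open>auto intro!: AE_I2\<close>)
    also have "\<dots> = (\<integral>u. radial L u ^ ?n / (real ?n * vol K) \<partial>spherical_lebesgue)"
    proof (intro Bochner_Integration.integral_cong refl)
      fix u assume "u \<in> space (spherical_lebesgue :: (real ^ 'n) measure)"
      then have "radial K u > 0" using K_pos by simp
      then show "radial K u ^ ?n / (real ?n * vol K) * (radial L u / radial K u) ^ ?n
          = radial L u ^ ?n / (real ?n * vol K)"
        by (simp add: power_divide)
    qed
    also have "\<dots> = vol L / vol K" by (simp add: integral_radial_power[OF L])
    finally have "expectation (\<lambda>u. (radial L u / radial K u) ^ ?n) = vol L / vol K" .
    moreover have "expectation f = expectation (\<lambda>u. 1 - (radial L u / radial K u) ^ ?n)"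
      by (rule Bochner_Integration.integral_cong) (auto simp: f_eq)
    ultimately show ?thesis
      using volK int_q prob_space by (simp add: diff_divide_distrib)
  qed
  have "(AE u in ?P. f u = expectation f) \<longleftrightarrow> dilates K L"
  proof
    assume ae: "AE u in ?P. f u = expectation f"
    define m where "m = expectation f"
    \<comment> \<open>A statement holding almost everywhere for a density says nothing where the
      density vanishes; here it is positive on the whole sphere.\<close>
    have "AE u in spherical_lebesgue. 0 < radial K u ^ ?n / (real ?n * vol K) \<longrightarrow> f u = m"
      using ae unfolding dual_cone_measure_def m_def by (subst (asm) AE_density) auto
    with AE_space have "AE u in spherical_lebesgue. f u = m"
      by eventually_elim (use K_pos volK in auto)
    then have "f u = m" if "norm u = 1" for u
      using AE_spherical_lebesgue_const_continuous[OF cont_f _ that] by simp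
    then have q: "(radial L u / radial K u) ^ ?n = 1 - m" if "norm u = 1" for u
      using f_eq[OF that] that by simp
    have ratio: "radial L u / radial K u = root ?n (1 - m)" if "norm u = 1" for u
      using K_pos[OF that] radial_nonneg[OF L that] unfolding q[OF that, symmetric]
      by (simp add: real_root_power_cancel)
    \<comment> \<open>One direction suffices to see that the constant ratio is positive, as
      \<open>dilates\<close> requires.\<close>
    obtain u :: "real ^ 'n" where u: "norm u = 1" using vector_choose_size[of 1] by auto
    have "0 < root ?n (1 - m)"
      unfolding ratio[OF u, symmetric] using K_pos[OF u] radial_pos[OF L u] by simp
    moreover have "radial L u = root ?n (1 - m) * radial K u" if "norm u = 1" for u
      using ratio[OF that] K_pos[OF that] by (simp add: field_simps)
    ultimately show "dilates K L"
      unfolding dilates_iff_radial[OF K L] by (intro exI[of _ "root ?n (1 - m)"]) simp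
  next
    assume "dilates K L"
    then obtain c where "\<forall>u\<in>sphere 0 1. radial L u = c * radial K u"
      unfolding dilates_iff_radial[OF K L] by blast
    then have f_const: "f u = 1 - c ^ ?n" if "norm u = 1" for u
      using f_eq[OF that] K_pos[OF that] that by simp
    then have "expectation f = expectation (\<lambda>_. 1 - c ^ ?n)"
      by (intro Bochner_Integration.integral_cong) auto
    then have "expectation f = 1 - c ^ ?n" using prob_space by simp
    with f_const show "AE u in ?P. f u = expectation f" by auto
  qed
  with expectation_ln_le_ln_expectation[OF int_f int_ln] f_pos
  show ?thesis unfolding Ef f_def[symmetric] by auto
qed

end
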